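(* Let $A,B\in\mathbb{Q}$ with $AB\neq 0$. (1) There are no trinomials $x^6+Ax^2+B$ of reducibility type $(1,2,3)$. (2) If $x^6+Ax^2+B$ has reducibility type $(2,2,2)$, then either $$(A,B)=\bigl(-s^2-sv-v^2,\,-sv(s+v)\bigr)\quad\text{for some } s,v\in\mathbb{Q},\ sv(s+v)\neq0,$$ with $x^6+Ax^2+B=(x^2+s)(x^2+v)(x^2-s-v)$; or, up to scaling, $$(A,B)=\bigl(-(v-1)(3v-1),\,-v^2(2v-1)\bigr)\quad\text{for some } v\in\mathbb{Q},\ v\neq0,1,\tfrac12,\tfrac13,$$ with $x^6+Ax^2+B=(x^2+x+v)(x^2-x+v)(x^2-2v+1)$.
   Context: A monic polynomial in $\mathbb{Q}[x]$ has reducibility type $(n_1,\dots,n_k)$, $n_1\le\dots\le n_k$, if it factors as a product of $k$ irreducible polynomials in $\mathbb{Q}[x]$ (not necessarily distinct) of degrees $n_1,\dots,n_k$. Trinomials are considered up to scaling: $x^n+Ax^m+B$ and $x^n+A\lambda^{n-m}x^m+B\lambda^n$ are identified for $\lambda\in\mathbb{Q}\setminus\{0\}$; "up to scaling $(A,B)=(A_0,B_0)$" means $(A,B)=(A_0\lambda^{n-m},B_0\lambda^n)$ for some $\lambda\in\mathbb{Q}\setminus\{0\}$ (and the factorization is that of the scaled trinomial). *)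

theory Defs
  imports "HOL-Computational_Algebra.Polynomial_Factorial"
begin

definition trinomial :: "nat \<Rightarrow> nat \<Rightarrow> rat \<Rightarrow> rat \<Rightarrow> rat poly" where
  "trinomial n m A B = monom 1 n + monom A m + [:B:]"

text \<open>The list \<open>ns\<close> of degrees is in nondecreasing order; the factors in \<open>ps\<close> may repeat.\<close>

definition has_reducibility_type :: "rat poly \<Rightarrow> nat list \<Rightarrow> bool" where
  "has_reducibility_type p ns \<longleftrightarrow>
     lead_coeff p = 1 \<and> sorted ns \<and>
     (\<exists>ps. p = prod_list ps \<and> (\<forall>q\<in>set ps. irreducible q) \<and> map degree ps = ns)"

text \<open>
  \<open>(A, B)\<close> equals \<open>(A0, B0)\<close> up to scaling, as coefficients of trinomials
  \<open>x^n + A x^m + B\<close>. This is meant for \<open>m \<le> n\<close>, where \<open>n - m\<close> does not truncate.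
\<close>

definition eq_up_to_scaling :: "nat \<Rightarrow> nat \<Rightarrow> rat \<times> rat \<Rightarrow> rat \<times> rat \<Rightarrow> bool" where
  "eq_up_to_scaling n m AB AB0 \<longleftrightarrow>
     (\<exists>l. l \<noteq> 0 \<and> AB = (fst AB0 * l ^ (n - m), snd AB0 * l ^ n))"

end

theory Submission
  imports Defs
begin

text \<open>
  The trinomial is even, so \<open>x \<mapsto> -x\<close> permutes its monic irreducible factors. It has no fixed
  linear factor other than \<open>x\<close>, which is excluded by \<open>B \<noteq> 0\<close>, so rational linear factors come in
  pairs: type \<open>(1,2,3)\<close> is impossible. In type \<open>(2,2,2)\<close> either all factors are fixed, i.e. of the
  form \<open>x\<^sup>2 + c\<close>, or there is one pair \<open>x\<^sup>2 \<plusminus> a x + b\<close> with \<open>a \<noteq> 0\<close>, and scaling by \<open>a\<close> makes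
  \<open>a = 1\<close>.
\<close>

lemma irreducible_imp_no_root:
  fixes q :: "'a::field poly"
  assumes "irreducible q" "degree q \<noteq> 1"
  shows "poly q x \<noteq> 0"
proof
  assume "poly q x = 0"
  then obtain r where r: "q = [:- x, 1:] * r"
    by (auto simp: poly_eq_0_iff_dvd)
  have "\<not> is_unit [:- x, 1:]"
    by (simp add: is_unit_iff_degree)
  with assms(1) r have "is_unit r"
    by (metis irreducibleD)
  moreover have "r \<noteq> 0"
    using assms(1) r by auto
  ultimately have "degree r = 0"
    by (simp add: is_unit_iff_degree)
  with \<open>r \<noteq> 0\<close> have "degree q = 1"
    unfolding r by (subst degree_mult_eq) auto
  with assms(2) show False ..
qed

text \<open>The factors counted by \<open>has_reducibility_type\<close> need not be monic. Dividing
  by the leading coefficient, a unit, preserves irreducibility and leaves only two coefficients to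
  track.\<close>

lemma irreducible_degree_2_E:
  fixes q :: "'a::field poly"
  assumes "irreducible q" "degree q = 2"
  obtains b a l where "q = smult l [:b, a, 1:]" "irreducible [:b, a, 1:]"
proof -
  define l where "l = lead_coeff q"
  have l: "l \<noteq> 0"
    using assms(1) by (auto simp: l_def)
  define m where "m = smult (inverse l) q"
  have ql: "q = smult l m"
    using l by (simp add: m_def)
  have "m = [:coeff m 0, coeff m 1, 1:]"
  proof (rule poly_eqI)
    fix n
    have "coeff m 2 = 1"
      using l assms(2) by (simp add: m_def l_def)
    moreover have "coeff m k = 0" if "k > 2" for k
      using that assms(2) by (simp add: m_def coeff_eq_0)
    ultimately show "coeff m n = coeff [:coeff m 0, coeff m 1, 1:] n"
      by (cases "n \<le> 2") (auto simp: coeff_pCons le_Suc_eq numeral_2_eq_2 split: nat.split)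
  qed
  moreover have "irreducible m"
    using assms(1) l irreducible_mult_unit_left[of "[:inverse l:]" q]
    by (simp add: m_def is_unit_iff_degree)
  ultimately show thesis
    using that ql by metis
qed

lemma monic_quadratic_dvd_iff:
  fixes a b c d :: "'a::field"
  shows "[:b, a, 1:] dvd [:d, c, 1:] \<longleftrightarrow> a = c \<and> b = d"
proof
  assume "[:b, a, 1:] dvd [:d, c, 1:]"
  then obtain r where r: "[:d, c, 1:] = [:b, a, 1:] * r" ..
  then have "r \<noteq> 0"
    by auto
  then have "degree [:d, c, 1:] = degree [:b, a, 1:] + degree r"
    unfolding r by (intro degree_mult_eq) auto
  then have "degree r = 0"
    by simp
  then obtain k where "r = [:k:]"
    by (rule degree_eq_zeroE)
  with r show "a = c \<and> b = d"
    by auto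
qed auto

text \<open>Substituting -x fixes \<open>p\<close> and negates the linear coefficient of each
  factor, so \<open>p\<close> is also the product of the reflected quadratics. An irreducible
  divisor is prime, hence divides one of them, and monic polynomials of equal degree dividing each
  other coincide.\<close>

lemma irreducible_quadratic_dvd_reflected_product:
  fixes p :: "'a::field poly"
  assumes "p = [:b1, a1, 1:] * [:b2, a2, 1:] * [:b3, a3, 1:]"
    and even: "pcompose p [:0, -1:] = p"
    and irr: "irreducible [:b, a, 1:]" and dvd: "[:b, a, 1:] dvd p"
  shows "(a = -a1 \<and> b = b1) \<or> (a = -a2 \<and> b = b2) \<or> (a = -a3 \<and> b = b3)"
proof -
  have "p = [:b1, -a1, 1:] * [:b2, -a2, 1:] * [:b3, -a3, 1:]"
    by (subst even[symmetric], unfold assms(1) pcompose_mult) (simp add: pcompose_pCons)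
  moreover have "prime_elem [:b, a, 1:]"
    using irr by (rule field_poly_irreducible_imp_prime)
  ultimately show ?thesis
    using dvd by (metis monic_quadratic_dvd_iff prime_elem_dvd_mult_iff)
qed

lemma trinomial_6_2_eq: "trinomial 6 2 A B = [:B, 0, A, 0, 0, 0, 1:]"
  by (simp add: trinomial_def monom_altdef eval_nat_numeral)

lemma trinomial_6_2_even: "pcompose (trinomial 6 2 A B) [:0, -1:] = trinomial 6 2 A B"
  by (simp add: trinomial_6_2_eq pcompose_pCons)

lemma poly_trinomial_6_2: "poly (trinomial 6 2 A B) x = x ^ 6 + A * x ^ 2 + B"
  by (simp add: trinomial_def poly_monom)

lemma trinomial_6_2_not_type_1_2_3:
  assumes "B \<noteq> 0"
  shows "\<not> has_reducibility_type (trinomial 6 2 A B) [1, 2, 3]"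
proof
  let ?p = "trinomial 6 2 A B"
  assume "has_reducibility_type ?p [1, 2, 3]"
  then obtain f g h where p: "?p = f * g * h"
    and irr: "irreducible g" "irreducible h"
    and deg: "degree f = 1" "degree g = 2" "degree h = 3"
    by (auto simp: has_reducibility_type_def map_eq_Cons_conv mult.assoc)
  \<comment> \<open>The irreducible quadratic and cubic have no rational roots, so every rational
    root comes from the linear factor \<open>f\<close>. Its only root \<open>r\<close> must
    therefore equal \<open>-r\<close>.\<close>
  have roots: "poly ?p x = 0 \<longleftrightarrow> poly f x = 0" for x
    unfolding p using irr deg by (simp add: irreducible_imp_no_root)
  obtain c d where f: "f = [:c, d:]" "d \<noteq> 0"
    using deg(1) by (metis degree1_coeffs)
  define r where "r = - c / d"
  have "poly f r = 0"
    using f by (simp add: r_def)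
  then have r: "poly ?p r = 0"
    by (simp add: roots)
  then have "poly ?p (-r) = 0"
    by (simp add: poly_trinomial_6_2)
  then have "poly f (-r) = 0"
    by (simp add: roots)
  with \<open>poly f r = 0\<close> f have "r = 0"
    by simp
  with r assms show False
    by (simp add: poly_trinomial_6_2)
qed

lemma trinomial_6_2_type_2_2_2_E:
  assumes "has_reducibility_type (trinomial 6 2 A B) [2, 2, 2]"
  obtains
    (fixed) b1 b2 b3 where "trinomial 6 2 A B = [:b1, 0, 1:] * [:b2, 0, 1:] * [:b3, 0, 1:]"
  | (swapped) a b c where "a \<noteq> 0"
      "trinomial 6 2 A B = [:b, a, 1:] * [:b, -a, 1:] * [:c, 0, 1:]"
proof -
  let ?p = "trinomial 6 2 A B"
  from assms obtain f g h where p: "?p = f * g * h"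
    and irr: "irreducible f" "irreducible g" "irreducible h"
    and deg: "degree f = 2" "degree g = 2" "degree h = 2"
    by (auto simp: has_reducibility_type_def map_eq_Cons_conv mult.assoc)
  obtain b1 a1 l1 where f: "f = smult l1 [:b1, a1, 1:]" "irreducible [:b1, a1, 1:]"
    using irr(1) deg(1) by (rule irreducible_degree_2_E)
  obtain b2 a2 l2 where g: "g = smult l2 [:b2, a2, 1:]" "irreducible [:b2, a2, 1:]"
    using irr(2) deg(2) by (rule irreducible_degree_2_E)
  obtain b3 a3 l3 where h: "h = smult l3 [:b3, a3, 1:]" "irreducible [:b3, a3, 1:]"
    using irr(3) deg(3) by (rule irreducible_degree_2_E)
  let ?m1 = "[:b1, a1, 1:]" and ?m2 = "[:b2, a2, 1:]" and ?m3 = "[:b3, a3, 1:]"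
  have pl: "?p = smult (l1 * l2 * l3) (?m1 * ?m2 * ?m3)"
    unfolding p f(1) g(1) h(1) by (simp only: mult_smult_left mult_smult_right smult_smult ac_simps)
  then have "lead_coeff ?p = l1 * l2 * l3"
    by (simp only: lead_coeff_smult lead_coeff_mult) simp
  then have "l1 * l2 * l3 = 1"
    by (simp add: trinomial_6_2_eq)
  with pl have m: "?p = ?m1 * ?m2 * ?m3"
    by simp
  \<comment> \<open>This is the coefficient of x^5.\<close>
  have sum: "a1 + a2 + a3 = 0"
    using m by (simp add: trinomial_6_2_eq algebra_simps)
  note partner = irreducible_quadratic_dvd_reflected_product[OF m trinomial_6_2_even]
  have 1: "(a1 = -a1 \<and> b1 = b1) \<or> (a1 = -a2 \<and> b1 = b2) \<or> (a1 = -a3 \<and> b1 = b3)"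
    by (rule partner[OF f(2)]) (simp only: m dvd_mult2 dvd_triv_left)
  have 2: "(a2 = -a1 \<and> b2 = b1) \<or> (a2 = -a2 \<and> b2 = b2) \<or> (a2 = -a3 \<and> b2 = b3)"
    by (rule partner[OF g(2)]) (simp only: m dvd_mult2 dvd_triv_right)
  \<comment> \<open>A factor with nonzero linear coefficient is not its own reflection, so it is
    paired with another factor; \<open>sum\<close> then makes the third linear coefficient
    vanish.\<close>
  from 1 2 sum consider "a1 = 0" "a2 = 0" "a3 = 0"
    | "a1 \<noteq> 0" "a2 = -a1" "b2 = b1" "a3 = 0"
    | "a1 \<noteq> 0" "a3 = -a1" "b3 = b1" "a2 = 0"
    | "a2 \<noteq> 0" "a3 = -a2" "b3 = b2" "a1 = 0"
    by force
  then show thesis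
  proof cases
    case 1
    with m show thesis
      by (intro fixed[of b1 b2 b3]) simp
  next
    case 2
    with m show thesis
      by (intro swapped[of a1 b1 b3]) simp_all
  next
    case 3
    with m show thesis
      by (intro swapped[of a1 b1 b2]) (simp_all only: ac_simps, simp_all)
  next
    case 4
    with m show thesis
      by (intro swapped[of a2 b2 b1]) (simp_all only: ac_simps, simp_all)
  qed
qed

theorem theorem4p3:
  fixes A B :: rat
  assumes "A * B \<noteq> 0"
  shows "\<not> has_reducibility_type (trinomial 6 2 A B) [1, 2, 3] \<and>
    (has_reducibility_type (trinomial 6 2 A B) [2, 2, 2] \<longrightarrow>
      (\<exists>s v :: rat. s * v * (s + v) \<noteq> 0 \<and>
        (A, B) = (- (s^2) - s * v - v^2, - (s * v * (s + v))) \<and>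
        trinomial 6 2 A B = [:s, 0, 1:] * [:v, 0, 1:] * [:- s - v, 0, 1:]) \<or>
      (\<exists>v A0 B0 :: rat. v \<noteq> 0 \<and> v \<noteq> 1 \<and> v \<noteq> 1/2 \<and> v \<noteq> 1/3 \<and>
        (A0, B0) = (- ((v - 1) * (3 * v - 1)), - (v^2 * (2 * v - 1))) \<and>
        eq_up_to_scaling 6 2 (A, B) (A0, B0) \<and>
        trinomial 6 2 A0 B0 = [:v, 1, 1:] * [:v, - 1, 1:] * [:- (2 * v) + 1, 0, 1:]))"
proof (intro conjI impI)
  have B: "B \<noteq> 0"
    using assms by auto
  then show "\<not> has_reducibility_type (trinomial 6 2 A B) [1, 2, 3]"
    by (rule trinomial_6_2_not_type_1_2_3)
  assume "has_reducibility_type (trinomial 6 2 A B) [2, 2, 2]"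
  then show "(\<exists>s v :: rat. s * v * (s + v) \<noteq> 0 \<and>
        (A, B) = (- (s^2) - s * v - v^2, - (s * v * (s + v))) \<and>
        trinomial 6 2 A B = [:s, 0, 1:] * [:v, 0, 1:] * [:- s - v, 0, 1:]) \<or>
      (\<exists>v A0 B0 :: rat. v \<noteq> 0 \<and> v \<noteq> 1 \<and> v \<noteq> 1/2 \<and> v \<noteq> 1/3 \<and>
        (A0, B0) = (- ((v - 1) * (3 * v - 1)), - (v^2 * (2 * v - 1))) \<and>
        eq_up_to_scaling 6 2 (A, B) (A0, B0) \<and>
        trinomial 6 2 A0 B0 = [:v, 1, 1:] * [:v, - 1, 1:] * [:- (2 * v) + 1, 0, 1:])"
    (is "?fixed \<or> ?swapped")
  proof (cases rule: trinomial_6_2_type_2_2_2_E)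
    case (fixed s v w)
    \<comment> \<open>The x^4 coefficient vanishes, which determines \<open>w\<close>; the x^2 and
      constant coefficients give \<open>A\<close> and \<open>B\<close>.\<close>
    then have w: "w = - s - v" and AB: "A = s * v + (s + v) * w" "B = s * v * w"
      by (auto simp: trinomial_6_2_eq algebra_simps)
    have "s * v * (s + v) \<noteq> 0"
      using B AB w by auto
    moreover have "A = - (s^2) - s * v - v^2" "B = - (s * v * (s + v))"
      unfolding AB w by (simp_all add: algebra_simps power2_eq_square)
    ultimately have ?fixed
      using fixed w by blast
    then show ?thesis ..
  next
    case (swapped a b c)
    \<comment> \<open>Substituting x = a y turns x^2 + a x + b into a^2 (y^2 + y + b/a^2), so
      \<open>v\<close> is the constant term after scaling.\<close>
    define v where "v = b / a^2"
    have b: "b = v * a^2"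
      using swapped(1) by (simp add: v_def)
    \<comment> \<open>The paired factors multiply to x^4 + (2b - a^2) x^2 + b^2. Multiplying by x^2
      + c and comparing coefficients of x^4, 1 and then x^2 yields \<open>c\<close>,
      \<open>B\<close> and \<open>A\<close>.\<close>
    have c: "c = a^2 - 2 * b" and B_eq: "B = b^2 * c"
      using swapped(2) by (auto simp: trinomial_6_2_eq algebra_simps power2_eq_square)
    have "A + a^2 * c = b^2 + 2 * b * c"
      using arg_cong[OF swapped(2)[unfolded trinomial_6_2_eq], of "\<lambda>p. coeff p 2"]
      by (simp add: numeral_2_eq_2 algebra_simps)
    then have A_eq: "A = b^2 + (2 * b - a^2) * c"
      by (simp add: algebra_simps)
    \<comment> \<open>Here c = a^2 (1 - 2v), so A = a^4 (v^2 - (2v - 1)^2), a difference of squares.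
      The excluded values of \<open>v\<close> are exactly the zeros of these expressions for
      \<open>A\<close> and \<open>B\<close>, and \<open>a\<close> is the scaling factor.\<close>
    have AB: "A = - ((v - 1) * (3 * v - 1)) * a^4" "B = - (v^2 * (2 * v - 1)) * a^6"
      unfolding A_eq B_eq c b by (simp_all add: algebra_simps eval_nat_numeral)
    with assms have "v \<noteq> 0" "v \<noteq> 1" "v \<noteq> 1/2" "v \<noteq> 1/3"
      by auto
    moreover have "eq_up_to_scaling 6 2 (A, B) (- ((v - 1) * (3 * v - 1)), - (v^2 * (2 * v - 1)))"
      unfolding eq_up_to_scaling_def using AB swapped(1) by (intro exI[of _ a]) simp
    moreover have "trinomial 6 2 (- ((v - 1) * (3 * v - 1))) (- (v^2 * (2 * v - 1)))
        = [:v, 1, 1:] * [:v, - 1, 1:] * [:- (2 * v) + 1, 0, 1:]"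
      by (simp add: trinomial_6_2_eq algebra_simps power2_eq_square)
    ultimately have ?swapped
      by blast
    then show ?thesis ..
  qed
qed

end
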